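(* Let $\pi$ be a $123$-avoiding permutation. If the downcore graph of the boundary grid of $\pi$ is pure, then $\pi$ avoids $2143$.
   Context: $\pi\in S_n$ avoids $123$ if there are no indices $p<q<r$ with $\pi_p<\pi_q<\pi_r$; $\pi$ contains $2143$ if there are indices $p<q<r<s$ with $\pi_q<\pi_p<\pi_s<\pi_r$, and avoids it otherwise. $\pi_i$ is a left-to-right minimum if $\pi_j>\pi_i$ for all $j<i$, and a right-to-left maximum if $\pi_j<\pi_i$ for all $j>i$. The boundary grid of a $123$-avoiding $\pi\in S_n$ is the set of boxes $(x,y)$, $1\le x,y\le n-1$ (the box being the unit square $[x,x+1]\times[y,y+1]$, $x$ its column from the left, $y$ its row from the bottom), such that there is a left-to-right minimum $\pi_i$ with $i\le x$ and $\pi_i\le y$, and a right-to-left maximum $\pi_j$ with $j\ge x+1$ and $\pi_j\ge y+1$. The downcore graph of a set $D$ of boxes has vertex set $D$, with an edge between $(i,j)$ and $(k,\ell)$ if and only if ($i<k$ and $j>\ell$, or $i>k$ and $j<\ell$) and both $(i,\ell)$ and $(k,j)$ belong to $D$. A graph is pure if all its maximal (with respect to inclusion) independent sets have the same size. *)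

theory Defs
  imports "HOL-Combinatorics.Permutations"
begin

(* A permutation in S_n is a function p :: nat => nat with p permutes {1..n};
   it is written in one-line notation as p 1, ..., p n. *)

definition avoids_123 :: "nat \<Rightarrow> (nat \<Rightarrow> nat) \<Rightarrow> bool" where
  "avoids_123 n \<pi> \<longleftrightarrow>
     \<not> (\<exists>p q r. 1 \<le> p \<and> p < q \<and> q < r \<and> r \<le> n \<and> \<pi> p < \<pi> q \<and> \<pi> q < \<pi> r)"

definition contains_2143 :: "nat \<Rightarrow> (nat \<Rightarrow> nat) \<Rightarrow> bool" where
  "contains_2143 n \<pi> \<longleftrightarrow>
     (\<exists>p q r s. 1 \<le> p \<and> p < q \<and> q < r \<and> r < s \<and> s \<le> n \<and>
        \<pi> q < \<pi> p \<and> \<pi> p < \<pi> s \<and> \<pi> s < \<pi> r)"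

abbreviation avoids_2143 :: "nat \<Rightarrow> (nat \<Rightarrow> nat) \<Rightarrow> bool" where
  "avoids_2143 n \<pi> \<equiv> \<not> contains_2143 n \<pi>"

definition left_to_right_min :: "nat \<Rightarrow> (nat \<Rightarrow> nat) \<Rightarrow> nat \<Rightarrow> bool" where
  "left_to_right_min n \<pi> i \<longleftrightarrow> i \<in> {1..n} \<and> (\<forall>j\<in>{1..n}. j < i \<longrightarrow> \<pi> j > \<pi> i)"

definition right_to_left_max :: "nat \<Rightarrow> (nat \<Rightarrow> nat) \<Rightarrow> nat \<Rightarrow> bool" where
  "right_to_left_max n \<pi> i \<longleftrightarrow> i \<in> {1..n} \<and> (\<forall>j\<in>{1..n}. j > i \<longrightarrow> \<pi> j < \<pi> i)"

(* The pair (x, y) stands for the unit square [x, x+1] \<times> [y, y+1]: x is its column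
   from the left, y its row from the bottom. *)
definition boundary_grid :: "nat \<Rightarrow> (nat \<Rightarrow> nat) \<Rightarrow> (nat \<times> nat) set" where
  "boundary_grid n \<pi> =
     {(x, y). 1 \<le> x \<and> x \<le> n - 1 \<and> 1 \<le> y \<and> y \<le> n - 1 \<and>
        (\<exists>i. left_to_right_min n \<pi> i \<and> i \<le> x \<and> \<pi> i \<le> y) \<and>
        (\<exists>j. right_to_left_max n \<pi> j \<and> j \<ge> x + 1 \<and> \<pi> j \<ge> y + 1)}"

(* A simple graph is a pair of a vertex set and a set of two-element sets of vertices. *)
type_synonym 'a graph = "'a set \<times> 'a set set"

definition downcore_graph :: "(nat \<times> nat) set \<Rightarrow> (nat \<times> nat) graph" where
  "downcore_graph D =
     (D, {{(i, j), (k, l)} | i j k l.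
            (i, j) \<in> D \<and> (k, l) \<in> D \<and>
            (i < k \<and> j > l \<or> i > k \<and> j < l) \<and> (i, l) \<in> D \<and> (k, j) \<in> D})"

definition independent_set :: "'a graph \<Rightarrow> 'a set \<Rightarrow> bool" where
  "independent_set G I \<longleftrightarrow> I \<subseteq> fst G \<and> (\<forall>u\<in>I. \<forall>v\<in>I. {u, v} \<notin> snd G)"

definition maximal_independent_set :: "'a graph \<Rightarrow> 'a set \<Rightarrow> bool" where
  "maximal_independent_set G I \<longleftrightarrow>
     independent_set G I \<and> (\<forall>J. independent_set G J \<and> I \<subseteq> J \<longrightarrow> J = I)"

(* Meant for finite graphs only: card is 0 on infinite sets. *)
definition pure_graph :: "'a graph \<Rightarrow> bool" where
  "pure_graph G \<longleftrightarrow>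
     (\<forall>I J. maximal_independent_set G I \<and> maximal_independent_set G J \<longrightarrow> card I = card J)"

end

theory Submission
  imports Defs
begin

text \<open>
  If \<^term>\<open>\<pi>\<close> contains 2143, the grid has a box \<open>c\<close> with two non-adjacent neighbours \<open>u\<close>, \<open>v\<close>
  to its north-west and south-east, and a small independent set \<open>K\<close>, adjacent to none of the three,
  such that every neighbour of \<open>u\<close> or \<open>v\<close> other than \<open>c\<close> is adjacent to \<open>K\<close>. A maximal independent
  set containing \<open>K\<close> and \<open>c\<close> then stays independent when \<open>c\<close> is exchanged for \<open>u\<close> and \<open>v\<close>, so the
  graph is not pure. The neighbours of \<open>v\<close> further to the south-east are under control
  because the occurrence of 2143 is taken with its last position as large as possible.
\<close>

lemma independent_set_extend_maximal:
  assumes "finite (fst G)" "independent_set G I"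
  obtains M where "maximal_independent_set G M" "I \<subseteq> M"
proof -
  let ?S = "{J. independent_set G J \<and> I \<subseteq> J}"
  have "?S \<subseteq> Pow (fst G)" by (auto simp: independent_set_def)
  then have "finite ?S" using assms(1) by (meson finite_Pow_iff finite_subset)
  moreover have "I \<in> ?S" using assms(2) by simp
  ultimately obtain M where M: "M \<in> ?S" "\<forall>J\<in>?S. M \<subseteq> J \<longrightarrow> M = J"
    using finite_has_maximal[of ?S] by blast
  then have "maximal_independent_set G M"
    unfolding maximal_independent_set_def by blast
  with M(1) that show thesis by blast
qed

text \<open>A neighbour of \<open>u\<close> or \<open>v\<close> other than \<open>c\<close> cannot
  lie in a maximal independent \<open>I\<close> containing \<open>K\<close>, being joined to a
  member of \<open>K\<close>. So trading \<open>c\<close> for \<open>u\<close> and \<open>v\<close>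
  creates no edge and gains one vertex; any maximal extension of the result is larger than
  \<open>I\<close>.\<close>

lemma not_pure_if_exchange:
  assumes fin: "finite (fst G)"
    and c: "independent_set G (insert c K)"
    and uv: "independent_set G (insert u (insert v K))"
    and adj: "{c, u} \<in> snd G" "{c, v} \<in> snd G" and "u \<noteq> v"
    and nu: "\<And>w. {u, w} \<in> snd G \<Longrightarrow> w = c \<or> (\<exists>k\<in>K. {k, w} \<in> snd G)"
    and nv: "\<And>w. {v, w} \<in> snd G \<Longrightarrow> w = c \<or> (\<exists>k\<in>K. {k, w} \<in> snd G)"
  shows "\<not> pure_graph G"
proof
  assume pure: "pure_graph G"
  obtain I where I: "maximal_independent_set G I" "insert c K \<subseteq> I"
    using independent_set_extend_maximal[OF fin c] .
  have indI: "independent_set G I" using I(1) by (simp add: maximal_independent_set_def)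
  have nouv: "u \<notin> I" "v \<notin> I"
    using indI I(2) adj by (auto simp: independent_set_def)
  define I' where "I' = insert u (insert v (I - {c}))"
  have no_u: "{u, w} \<notin> snd G" and no_v: "{v, w} \<notin> snd G" if "w \<in> I - {c}" for w
    using nu nv that indI I(2) unfolding independent_set_def by blast+
  have rest: "{a, b} \<notin> snd G" if "a \<in> I - {c}" "b \<in> I - {c}" for a b
    using indI that unfolding independent_set_def by blast
  have "{u, u} \<notin> snd G" "{u, v} \<notin> snd G" "{v, u} \<notin> snd G" "{v, v} \<notin> snd G"
    using uv unfolding independent_set_def by blast+
  \<comment> \<open>The commuted copies cover \<open>{w, u}\<close> and \<open>{w, v}\<close>, so
    every ordered pair from \<open>I'\<close> matches one of these facts literally.\<close>
  note non_edges = this no_u no_v rest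
    no_u[unfolded insert_commute[of u]] no_v[unfolded insert_commute[of v]]
  have "{a, b} \<notin> snd G" if "a \<in> I'" "b \<in> I'" for a b
    using that unfolding I'_def
    by (elim insertE) (simp_all only: non_edges not_False_eq_True)
  moreover have "I' \<subseteq> fst G"
    using uv indI unfolding I'_def independent_set_def by auto
  ultimately have "independent_set G I'" by (simp add: independent_set_def)
  then obtain J where J: "maximal_independent_set G J" "I' \<subseteq> J"
    using independent_set_extend_maximal[OF fin] by blast
  have "finite J" "finite I"
    using J(1) I(1) fin
    by (auto simp: maximal_independent_set_def independent_set_def intro: finite_subset)
  have "card I' = Suc (card I)"
    unfolding I'_def using nouv \<open>u \<noteq> v\<close> \<open>finite I\<close> I(2)
    using card_Suc_Diff1[of I c] by simp
  then have "card I < card J"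
    using card_mono[OF \<open>finite J\<close> J(2)] by simp
  moreover have "card I = card J"
    using pure I(1) J(1) unfolding pure_graph_def by blast
  ultimately show False by simp
qed

lemma downcore_graph_edge_iff:
  "{(a, b), (c, d)} \<in> snd (downcore_graph D) \<longleftrightarrow>
     (a, b) \<in> D \<and> (c, d) \<in> D \<and> (a < c \<and> b > d \<or> a > c \<and> b < d) \<and> (a, d) \<in> D \<and> (c, b) \<in> D"
  unfolding downcore_graph_def by (auto simp: doubleton_eq_iff)

lemma downcore_graph_no_loop: "{z} \<notin> snd (downcore_graph D)"
  unfolding downcore_graph_def by (auto simp: singleton_insert_inj_eq)

text \<open>The least value among the positions up to \<open>x\<close> is attained at a
  left-to-right minimum, the greatest among the later ones at a right-to-left maximum. Hence
  arbitrary points can replace the extremal ones, and their existence forces the bounds on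
  \<open>x\<close> and \<open>y\<close>.\<close>

lemma boundary_grid_iff:
  assumes perm: "\<pi> permutes {1..n}"
  shows "(x, y) \<in> boundary_grid n \<pi> \<longleftrightarrow>
     (\<exists>i\<in>{1..n}. i \<le> x \<and> \<pi> i \<le> y) \<and> (\<exists>j\<in>{1..n}. j > x \<and> \<pi> j > y)"
    (is "_ \<longleftrightarrow> ?A \<and> ?B")
proof
  assume "(x, y) \<in> boundary_grid n \<pi>"
  then show "?A \<and> ?B"
    unfolding boundary_grid_def left_to_right_min_def right_to_left_max_def
    by (auto simp: Suc_le_eq)
next
  have inj: "\<pi> a = \<pi> b \<longleftrightarrow> a = b" for a b
    using permutes_inj[OF perm] by (auto simp: inj_def)
  have range: "\<pi> a \<in> {1..n}" if "a \<in> {1..n}" for a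
    using permutes_in_image[OF perm] that by simp
  assume AB: "?A \<and> ?B"
  then obtain i0 j0 where i0: "i0 \<in> {1..n}" "i0 \<le> x" "\<pi> i0 \<le> y"
    and j0: "j0 \<in> {1..n}" "j0 > x" "\<pi> j0 > y" by auto
  obtain i where i: "i \<in> {1..n} \<and> i \<le> x" "\<And>k. k \<in> {1..n} \<and> k \<le> x \<Longrightarrow> \<pi> i \<le> \<pi> k"
    using ex_has_least_nat[of "\<lambda>i. i \<in> {1..n} \<and> i \<le> x" i0 \<pi>] i0 by blast
  have bound: "\<forall>k. k \<in> {1..n} \<and> k > x \<longrightarrow> \<pi> k < Suc n"
    using range by (auto simp: less_Suc_eq_le)
  obtain j where j: "j \<in> {1..n} \<and> j > x" "\<And>k. k \<in> {1..n} \<and> k > x \<Longrightarrow> \<pi> k \<le> \<pi> j"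
    using ex_has_greatest_nat[of "\<lambda>j. j \<in> {1..n} \<and> j > x" j0 \<pi> "Suc n"] j0 bound by blast
  have "\<pi> i < \<pi> k" if "k \<in> {1..n}" "k < i" for k
    using i(2)[of k] i(1) inj[of i k] that by (simp add: order_less_le)
  then have "left_to_right_min n \<pi> i"
    unfolding left_to_right_min_def using i(1) by blast
  moreover have "\<pi> k < \<pi> j" if "k \<in> {1..n}" "j < k" for k
    using j(2)[of k] j(1) inj[of k j] that by (simp add: order_less_le)
  then have "right_to_left_max n \<pi> j"
    unfolding right_to_left_max_def using j(1) by blast
  moreover have "\<pi> i \<le> y" using i(2)[of i0] i0 by simp
  moreover have "\<pi> j \<ge> y + 1" using j(2)[of j0] j0 by simp
  moreover have "1 \<le> x" "x \<le> n - 1" "1 \<le> y" "y \<le> n - 1"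
    using i0 j0 range[of i0] range[of j0] by auto
  ultimately show "(x, y) \<in> boundary_grid n \<pi>"
    unfolding boundary_grid_def using i(1) j(1) by auto
qed

lemma finite_boundary_grid: "finite (boundary_grid n \<pi>)"
  by (rule finite_subset[of _ "{..n} \<times> {..n}"]) (auto simp: boundary_grid_def)

theorem theorem3p12:
  fixes n :: nat and \<pi> :: "nat \<Rightarrow> nat"
  assumes "\<pi> permutes {1..n}"
    and "avoids_123 n \<pi>"
    and "pure_graph (downcore_graph (boundary_grid n \<pi>))"
  shows "avoids_2143 n \<pi>"
proof
  assume contains: "contains_2143 n \<pi>"
  let ?P = "\<lambda>p q r s. 1 \<le> p \<and> p < q \<and> q < r \<and> r < s \<and> s \<le> n \<and>
    \<pi> q < \<pi> p \<and> \<pi> p < \<pi> s \<and> \<pi> s < \<pi> r"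
  have inj: "\<pi> a = \<pi> b \<longleftrightarrow> a = b" for a b
    using permutes_inj[OF assms(1)] by (auto simp: inj_def)
  have range: "1 \<le> \<pi> a \<and> \<pi> a \<le> n" if "1 \<le> a" "a \<le> n" for a
    using permutes_in_image[OF assms(1), of a] that by simp
  have no123: "\<not> (\<pi> a < \<pi> b \<and> \<pi> b < \<pi> c)" if "1 \<le> a" "a < b" "b < c" "c \<le> n" for a b c
    using assms(2) that unfolding avoids_123_def by blast
  obtain s0 where "\<exists>p q r. ?P p q r s0" using contains unfolding contains_2143_def by blast
  moreover have "\<forall>s. (\<exists>p q r. ?P p q r s) \<longrightarrow> s < Suc n" by auto
  ultimately obtain s where "\<exists>p q r. ?P p q r s"
    and s_max: "\<And>p q r s'. ?P p q r s' \<Longrightarrow> s' \<le> s"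
    using ex_has_greatest_nat[of "\<lambda>s. \<exists>p q r. ?P p q r s" s0 "\<lambda>s. s" "Suc n"] by blast
  then obtain p0 q r0 where P0: "?P p0 q r0 s" by blast
  \<comment> \<open>With \<open>q\<close> and \<open>s\<close> kept, \<open>p\<close> becomes the
    position of the lowest point before \<open>q\<close> and \<open>r\<close> the last position with
    a value above \<open>\<pi> s\<close>. Avoidance of 123 shows below that the pattern
    survives.\<close>
  obtain p where p: "1 \<le> p" "p < q" and p_min: "\<And>i. 1 \<le> i \<Longrightarrow> i < q \<Longrightarrow> \<pi> p \<le> \<pi> i"
    using ex_has_least_nat[of "\<lambda>i. 1 \<le> i \<and> i < q" p0 \<pi>] P0 by blast
  have "\<forall>j. j \<le> n \<and> \<pi> s < \<pi> j \<longrightarrow> j < Suc n" by auto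
  then obtain r where r: "r \<le> n" "\<pi> s < \<pi> r" and r_last: "\<And>j. j \<le> n \<Longrightarrow> \<pi> s < \<pi> j \<Longrightarrow> j \<le> r"
    using ex_has_greatest_nat[of "\<lambda>j. j \<le> n \<and> \<pi> s < \<pi> j" r0 "\<lambda>j. j" "Suc n"] P0
    by (meson less_imp_le order_trans)
  have ps: "\<pi> p < \<pi> s" using p_min[of p0] P0 by simp
  have qp: "\<pi> q < \<pi> p" using no123[of p q s] P0 p inj[of p q] by linarith
  have qr: "q < r" using r_last[of r0] P0 by simp
  have rs: "r < s"
  proof (rule ccontr)
    assume "\<not> r < s"
    then have "s < r" using r by (cases "r = s") auto
    with no123[of p s r] P0 p ps r show False by simp
  qed
  note ord = p qr rs qp ps r(2) P0

  \<comment> \<open>\<open>A\<close> asks for a point weakly south-west of the lower left corner of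
    the box, \<open>B\<close> for one weakly north-east of its upper right corner
    \<open>(x + 1, y + 1)\<close>.\<close>
  define A where "A x y \<longleftrightarrow> (\<exists>i\<in>{1..n}. i \<le> x \<and> \<pi> i \<le> y)" for x y
  define B where "B x y \<longleftrightarrow> (\<exists>j\<in>{1..n}. j > x \<and> \<pi> j > y)" for x y
  have D: "(x, y) \<in> boundary_grid n \<pi> \<longleftrightarrow> A x y \<and> B x y" for x y
    unfolding boundary_grid_iff[OF assms(1)] A_def B_def ..
  have A_mono: "A x' y'" if "A x y" "x \<le> x'" "y \<le> y'" for x y x' y'
    using that unfolding A_def by (meson le_trans)
  have B_mono: "B x' y'" if "B x y" "x' \<le> x" "y' \<le> y" for x y x' y'
    using that unfolding B_def by (meson le_less_trans)
  \<comment> \<open>The box \<open>c = (q, y)\<close> is the north-west corner of the rectangle \<open>[q, r] \<times> [\<pi> p, \<pi> s]\<close>;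
    \<open>u = (x, y + 1)\<close> touches that corner, and \<open>v = (r, l)\<close> touches the opposite one.\<close>
  define x y l where "x = q - 1" and "y = \<pi> s - 1" and "l = \<pi> p - 1"
  have xyl: "q = Suc x" "\<pi> s = Suc y" "\<pi> p = Suc l" "l < y" "x < r - 1" "q < r"
    using ord by (auto simp: x_def y_def l_def)
  have A1: "A x (Suc l)" unfolding A_def using ord xyl by (intro bexI[where x = p]) auto
  have A2: "\<not> A x l"
  proof
    assume "A x l"
    then obtain i where "1 \<le> i" "i < q" "\<pi> i < \<pi> p" using xyl unfolding A_def by auto
    with p_min[of i] show False by simp
  qed
  have A3: "A q l" unfolding A_def using ord xyl by (intro bexI[where x = q]) auto
  \<comment> \<open>The only point at height \<open>\<pi> s\<close> is at position \<open>s\<close>,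
    to the right of \<open>a\<close>, so lowering the row by one loses nothing.\<close>
  have A4: "A a y" if a: "A a (Suc y)" "a < x" for a
  proof -
    obtain i where i: "1 \<le> i" "i \<le> a" "i \<le> n" "\<pi> i \<le> \<pi> s" using a xyl unfolding A_def by auto
    have "\<pi> i \<noteq> \<pi> s" using i a xyl ord inj[of i s] by auto
    with i xyl show ?thesis unfolding A_def by auto
  qed
  have B1: "B (r - 1) (Suc y)" unfolding B_def using ord xyl by (intro bexI[where x = r]) auto
  have B2: "\<not> B r (Suc y)"
  proof
    assume "B r (Suc y)"
    then obtain j where "j \<le> n" "r < j" "\<pi> s < \<pi> j" using xyl unfolding B_def by auto
    with r_last[of j] show False by simp
  qed
  have B3: "B r y" unfolding B_def using ord xyl by (intro bexI[where x = s]) auto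
  \<comment> \<open>If both failed, the witness \<open>i\<close> of \<open>A r b\<close> would lie
    strictly between \<open>q\<close> and \<open>r\<close>, and the witness \<open>j\<close> of
    \<open>B a l\<close> beyond \<open>s\<close> and below \<open>\<pi> s\<close>. Then
    \<open>q\<close>, \<open>i\<close>, \<open>s\<close>, \<open>j\<close> form a 2143 ending after
    \<open>s\<close>.\<close>
  have AB: "A q b \<or> B a y" if ab: "r < a" "b < l" "A r b" "B a l" for a b
  proof (rule ccontr)
    assume neg: "\<not> (A q b \<or> B a y)"
    obtain i where i: "1 \<le> i" "i \<le> r" "\<pi> i \<le> b" using ab unfolding A_def by auto
    obtain j where j: "a < j" "j \<le> n" "l < \<pi> j" using ab unfolding B_def by auto
    have nA: "b < \<pi> k" if "k \<in> {1..n}" "k \<le> q" for k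
      using neg that unfolding A_def by (meson not_le)
    have nB: "\<pi> k \<le> y" if "k \<in> {1..n}" "a < k" for k
      using neg that unfolding B_def by (meson not_le)
    have "q < i" using nA[of i] i ord by fastforce
    moreover have "b < \<pi> q" using nA[of q] ord by simp
    moreover have "s \<le> a" using nB[of s] xyl ord by fastforce
    moreover have "\<pi> j \<le> y" using nB[of j] j by simp
    moreover have "i \<noteq> r" using i ord ab xyl by auto
    ultimately have "?P q i s j" using i j ord xyl ab by auto
    then have "j \<le> s" by (rule s_max)
    with \<open>s \<le> a\<close> j show False by simp
  qed

  let ?G = "downcore_graph (boundary_grid n \<pi>)"
  \<comment> \<open>The first two boxes handle all neighbours of \<open>u\<close> and the north-west
    ones of \<open>v\<close>; the last two handle the south-east ones of \<open>v\<close>.\<close>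
  let ?K = "{(x, y), (q, Suc y), (r, y), (q, l)}"
  have mem: "(x, y) \<in> boundary_grid n \<pi>" "(q, Suc y) \<in> boundary_grid n \<pi>" "(r, y) \<in> boundary_grid n \<pi>"
    "(q, l) \<in> boundary_grid n \<pi>" "(q, y) \<in> boundary_grid n \<pi>" "(x, Suc y) \<in> boundary_grid n \<pi>"
    "(r, l) \<in> boundary_grid n \<pi>"
    unfolding D using A_mono[OF A1] A_mono[OF A3] B_mono[OF B1] B_mono[OF B3] xyl by auto
  \<comment> \<open>Apart from the pairs \<open>c\<close>, \<open>u\<close> and \<open>c\<close>,
    \<open>v\<close>, any two of the boxes \<open>c\<close>, \<open>u\<close>, \<open>v\<close> and
    those of \<open>?K\<close> that lie north-west and south-east of each other have one of these
    missing boxes as a corner.\<close>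
  have nmem: "(x, l) \<notin> boundary_grid n \<pi>" "(r, Suc y) \<notin> boundary_grid n \<pi>"
    using D A2 B2 by auto
  have fst: "fst ?G = boundary_grid n \<pi>" by (simp add: downcore_graph_def)
  have "\<not> pure_graph ?G"
  proof (rule not_pure_if_exchange[where c = "(q, y)" and u = "(x, Suc y)" and v = "(r, l)" and K = ?K])
    show "finite (fst ?G)" unfolding fst by (rule finite_boundary_grid)
    show "independent_set ?G (insert (q, y) ?K)"
      unfolding independent_set_def fst using mem nmem xyl
      by (auto simp: downcore_graph_edge_iff downcore_graph_no_loop)
    show "independent_set ?G (insert (x, Suc y) (insert (r, l) ?K))"
      unfolding independent_set_def fst using mem nmem xyl
      by (auto simp: downcore_graph_edge_iff downcore_graph_no_loop)
    show "{(q, y), (x, Suc y)} \<in> snd ?G" "{(q, y), (r, l)} \<in> snd ?G"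
      using mem xyl by (auto simp: downcore_graph_edge_iff)
    show "(x, Suc y) \<noteq> (r, l)" using xyl by auto
  next
    fix w assume w: "{(x, Suc y), w} \<in> snd ?G"
    obtain a b where ab: "w = (a, b)" by fastforce
    from w ab consider "x < a" "b < Suc y" | "a < x" "Suc y < b"
      by (auto simp: downcore_graph_edge_iff)
    then show "w = (q, y) \<or> (\<exists>k\<in>?K. {k, w} \<in> snd ?G)"
    proof cases
      case 1
      have "{(x, y), w} \<in> snd ?G" if "b < y"
        using w 1 that mem D A_mono[of a b a y] B_mono[of a "Suc y" a y]
        unfolding ab downcore_graph_edge_iff by auto
      moreover have "{(q, Suc y), w} \<in> snd ?G" if "b = y" "a \<noteq> q"
        using w 1 that mem xyl unfolding ab downcore_graph_edge_iff by auto
      ultimately show ?thesis using 1 ab by (cases "b < y"; cases "a = q") auto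
    next
      case 2
      have "{(x, y), w} \<in> snd ?G"
        using w 2 mem D A4[of a] B_mono[of a "Suc y" a y]
        unfolding ab downcore_graph_edge_iff by auto
      then show ?thesis by blast
    qed
  next
    fix w assume w: "{(r, l), w} \<in> snd ?G"
    obtain a b where ab: "w = (a, b)" by fastforce
    from w ab consider "a < r" "l < b" | "r < a" "b < l"
      by (auto simp: downcore_graph_edge_iff)
    then show "w = (q, y) \<or> (\<exists>k\<in>?K. {k, w} \<in> snd ?G)"
    proof cases
      case 1
      have wD: "A a l" "B r b" "(a, b) \<in> boundary_grid n \<pi>"
        using w D unfolding ab downcore_graph_edge_iff by auto
      \<comment> \<open>\<open>A2\<close> and \<open>B2\<close> confine \<open>w\<close> to columns
        from \<open>q\<close> on and rows up to \<open>y\<close>, where \<open>(x, y)\<close> or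
        \<open>(q, Suc y)\<close> is adjacent to it unless it is \<open>c\<close>.\<close>
      have "q \<le> a" using A_mono[OF wD(1), of x l] A2 xyl by (cases "a \<le> x") auto
      moreover have "b \<le> y" using B_mono[OF wD(2), of r "Suc y"] B2 by (cases "b \<le> y") auto
      moreover have "{(x, y), w} \<in> snd ?G" if "b < y"
        using wD 1 that mem D A_mono[OF A1, of x b] A_mono[of a l a y] B_mono[OF B3, of a y] B_mono[OF B3, of x b]
          \<open>q \<le> a\<close> xyl
        unfolding ab downcore_graph_edge_iff by auto
      moreover have "{(q, Suc y), w} \<in> snd ?G" if "b = y" "q < a"
        using wD 1 that mem D A_mono[of a l a "Suc y"] B_mono[OF B1, of a "Suc y"] xyl
        unfolding ab downcore_graph_edge_iff by auto
      ultimately show ?thesis using ab by (cases "b < y"; cases "a = q") auto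
    next
      case 2
      have wD: "A r b" "B r b" "A a l" "B a l" "(a, b) \<in> boundary_grid n \<pi>"
        using w D unfolding ab downcore_graph_edge_iff by auto
      from AB[OF 2 wD(1,4)] show ?thesis
      proof
        assume "A q b"
        then have "{(q, l), w} \<in> snd ?G"
          using wD 2 mem D B_mono[OF wD(2), of q b] xyl
          unfolding ab downcore_graph_edge_iff by auto
        then show ?thesis by blast
      next
        assume "B a y"
        then have "{(r, y), w} \<in> snd ?G"
          using wD 2 mem D A_mono[OF wD(3), of a y] xyl
          unfolding ab downcore_graph_edge_iff by auto
        then show ?thesis by blast
      qed
    qed
  qed
  with assms(3) show False by contradiction
qed

end
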